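(* Let $G=(V,E)$ be a finite simple connected graph. For every signing $\sigma$ of $G$, encoded by $s\in\mathbb F_2^E$, and every even $\ell$, $$\operatorname{tr}\bigl(A_\sigma^\ell\bigr)=\sum_{z\in Z_{\mathrm{ev}}}N_\ell(z)\,(-1)^{s\cdot z},$$ where $N_\ell(z)\ge0$ is the number of closed walks of length $\ell$ in $G$ with parity vector $z$, independent of $\sigma$.
   Context: A signing is $\sigma\in\{\pm1\}^E$, encoded by $s\in\mathbb F_2^E$ with $\sigma_e=(-1)^{s_e}$; $A_\sigma$ is the signed adjacency matrix with $uv$ entry $\sigma_{uv}$ if $uv\in E$ and $0$ otherwise. $Z(G)\le\mathbb F_2^E$ is the cycle space, and $Z_{\mathrm{ev}}=\{z\in Z(G):|z|\text{ even}\}$, where $|z|$ is the number of nonzero coordinates. For a closed walk $w$ (with marked starting vertex and direction), its parity vector $z(w)\in\mathbb F_2^E$ has $z(w)_e$ equal to the number of traversals of $e$ by $w$ modulo $2$. *)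

theory Defs
  imports "HOL-Analysis.Analysis" "HOL-Library.Z2"
begin

(* The vertex set is the universe of a finite type 'v, and edges are two-element
   sets of vertices.  Since types are nonempty, so is the vertex set. *)

definition simple_graph :: "'v set set \<Rightarrow> bool" where
  "simple_graph E \<longleftrightarrow> (\<forall>e\<in>E. \<exists>u v. u \<noteq> v \<and> e = {u, v})"

definition connected_graph :: "'v set set \<Rightarrow> bool" where
  "connected_graph E \<longleftrightarrow> (\<forall>u v. (u, v) \<in> {(x, y). {x, y} \<in> E}\<^sup>*)"

(* F_2^E is represented by total functions on sets of vertices that vanish outside E,
   so that each vector has exactly one representative. *)
definition F2_space :: "'v set set \<Rightarrow> ('v set \<Rightarrow> bit) set" where
  "F2_space E = {x. \<forall>e. e \<notin> E \<longrightarrow> x e = 0}"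

definition F2_dot :: "'v set set \<Rightarrow> ('v set \<Rightarrow> bit) \<Rightarrow> ('v set \<Rightarrow> bit) \<Rightarrow> bit" where
  "F2_dot E x y = (\<Sum>e\<in>E. x e * y e)"

definition F2_weight :: "'v set set \<Rightarrow> ('v set \<Rightarrow> bit) \<Rightarrow> nat" where
  "F2_weight E x = card {e\<in>E. x e \<noteq> 0}"

(* (-1)^b for b in F_2 *)
definition sign_of_bit :: "bit \<Rightarrow> real" where
  "sign_of_bit b = (if b = 0 then 1 else -1)"

(* The kernel over F_2 of the vertex-edge incidence map. *)
definition cycle_space :: "'v set set \<Rightarrow> ('v set \<Rightarrow> bit) set" where
  "cycle_space E = {z \<in> F2_space E. \<forall>v. (\<Sum>e\<in>{e\<in>E. v \<in> e}. z e) = 0}"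

definition even_cycle_space :: "'v set set \<Rightarrow> ('v set \<Rightarrow> bit) set" where
  "even_cycle_space E = {z \<in> cycle_space E. even (F2_weight E z)}"

definition signing :: "'v set set \<Rightarrow> ('v set \<Rightarrow> real) \<Rightarrow> bool" where
  "signing E \<sigma> \<longleftrightarrow> (\<forall>e\<in>E. \<sigma> e = 1 \<or> \<sigma> e = -1)"

definition encodes_signing ::
    "'v set set \<Rightarrow> ('v set \<Rightarrow> bit) \<Rightarrow> ('v set \<Rightarrow> real) \<Rightarrow> bool" where
  "encodes_signing E s \<sigma> \<longleftrightarrow> s \<in> F2_space E \<and> (\<forall>e\<in>E. \<sigma> e = sign_of_bit (s e))"

definition signed_adjacency :: "'v::finite set set \<Rightarrow> ('v set \<Rightarrow> real) \<Rightarrow> real^'v^'v" where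
  "signed_adjacency E \<sigma> = (\<chi> u v. if {u, v} \<in> E then \<sigma> {u, v} else 0)"

primrec matrix_power :: "'a::semiring_1^'n^'n \<Rightarrow> nat \<Rightarrow> 'a^'n^'n" where
  "matrix_power A 0 = mat 1"
| "matrix_power A (Suc k) = A ** matrix_power A k"

(* A walk of length l is the sequence of its l + 1 vertices, so a closed walk comes with
   a marked starting vertex and a direction; its last entry repeats the first. *)
definition closed_walk :: "'v set set \<Rightarrow> nat \<Rightarrow> 'v list \<Rightarrow> bool" where
  "closed_walk E l w \<longleftrightarrow>
     length w = Suc l \<and> (\<forall>i<l. {w ! i, w ! Suc i} \<in> E) \<and> w ! l = w ! 0"

definition parity_vector :: "'v list \<Rightarrow> 'v set \<Rightarrow> bit" where
  "parity_vector w e = of_nat (card {i. Suc i < length w \<and> {w ! i, w ! Suc i} = e})"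

definition num_closed_walks :: "'v set set \<Rightarrow> nat \<Rightarrow> ('v set \<Rightarrow> bit) \<Rightarrow> nat" where
  "num_closed_walks E l z = card {w. closed_walk E l w \<and> parity_vector w = z}"

(* Finiteness, so that neither the card above nor a sum over even_cycle_space
   takes its default value 0. *)

lemma finite_closed_walks:
  fixes E :: "'v::finite set set"
  shows "finite {w. closed_walk E l w}"
  by (rule finite_subset[OF _ finite_lists_length_eq[of UNIV "Suc l"]])
    (auto simp: closed_walk_def)

lemma finite_even_cycle_space:
  fixes E :: "'v::finite set set"
  shows "finite (even_cycle_space E)"
proof -
  have "finite (UNIV :: bit set)"
    by (rule finite_subset[of _ "{0, 1}"]) (use bit_not_zero_iff in blast, simp)
  then have "finite {f :: 'v set \<Rightarrow> bit. \<forall>x. (x \<in> UNIV \<longrightarrow> f x \<in> UNIV) \<and> (x \<notin> UNIV \<longrightarrow> f x = 0)}"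
    by (intro finite_set_of_finite_funs) auto
  then show ?thesis
    by (rule finite_subset[rotated]) auto
qed

end

theory Submission
  imports Defs
begin

text \<open>
  Expanding the matrix power, the trace is the sum over closed walks of the product of the signs
  traversed, and that product depends only on the parity vector of the walk. Modulo 2, the parity
  vector of a walk from \<open>u\<close> to \<open>v\<close> has boundary \<open>u + v\<close> and weight
  equal to the length, so for closed walks of even length it lies in the even cycle space;
  grouping the walks by parity vector gives the formula.
\<close>

text \<open>Inductions peel off the first vertex, which breaks closedness; leaving both ends free
  keeps the claim inductive. Closed walks are recovered as the union of the diagonal sets
  \<open>walks E l u u\<close>.\<close>

definition walks :: "'v set set \<Rightarrow> nat \<Rightarrow> 'v \<Rightarrow> 'v \<Rightarrow> 'v list set" where
  "walks E l u v =
     {w. length w = Suc l \<and> (\<forall>i<l. {w ! i, w ! Suc i} \<in> E) \<and> w ! 0 = u \<and> w ! l = v}"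

lemma finite_walks:
  fixes E :: "'v::finite set set"
  shows "finite (walks E l u v)"
  by (rule finite_subset[OF _ finite_lists_length_eq[of UNIV "Suc l"]]) (auto simp: walks_def)

lemma walks_0: "walks E 0 u v = (if u = v then {[u]} else {})"
  by (auto simp: walks_def length_Suc_conv)

lemma walks_Suc: "walks E (Suc l) u v = (\<Union>x\<in>{x. {u, x} \<in> E}. (#) u ` walks E l x v)"
proof (intro equalityI subsetI)
  fix w assume w: "w \<in> walks E (Suc l) u v"
  then obtain w' where w': "w = u # w'"
    by (cases w) (auto simp: walks_def)
  have "{u, w' ! 0} \<in> E"
    using w w' by (auto simp: walks_def)
  moreover have "w' \<in> walks E l (w' ! 0) v"
    using w w' by (auto simp: walks_def dest: spec[of _ "Suc _"])
  ultimately show "w \<in> (\<Union>x\<in>{x. {u, x} \<in> E}. (#) u ` walks E l x v)"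
    using w' by blast
next
  fix w assume "w \<in> (\<Union>x\<in>{x. {u, x} \<in> E}. (#) u ` walks E l x v)"
  then show "w \<in> walks E (Suc l) u v"
    by (auto simp: walks_def nth_Cons' less_Suc_eq_0_disj)
qed

lemma sum_walks_Suc:
  fixes E :: "'v::finite set set"
  shows "(\<Sum>w\<in>walks E (Suc l) u v. f w) =
    (\<Sum>x | {u, x} \<in> E. \<Sum>w\<in>walks E l x v. f (u # w))"
proof -
  have "(\<Sum>w\<in>walks E (Suc l) u v. f w) = (\<Sum>x | {u, x} \<in> E. sum f ((#) u ` walks E l x v))"
    \<comment> \<open>The pieces are disjoint because entry 1 of a walk recovers the chosen
      neighbour \<open>x\<close>.\<close>
    unfolding walks_Suc by (rule sum.UNION_disjoint) (simp_all add: finite_walks, auto simp: walks_def)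
  then show ?thesis
    by (simp add: sum.reindex)
qed

lemma parity_vector_singleton: "parity_vector [u] e = 0"
  by (simp add: parity_vector_def)

text \<open>The new edge sits at index 0 and every old index shifts by one. An empty
  \<open>w\<close> would give no new edge, and \<open>w ! 0\<close> would be unspecified.\<close>

lemma parity_vector_Cons:
  assumes "w \<noteq> []"
  shows "parity_vector (u # w) e = of_bool ({u, w ! 0} = e) + parity_vector w e"
proof -
  let ?I = "{i. Suc i < length w \<and> {w ! i, w ! Suc i} = e}"
  have fin: "finite ?I"
    by (rule finite_subset[of _ "{..<length w}"]) auto
  have "{i. Suc i < length (u # w) \<and> {(u # w) ! i, (u # w) ! Suc i} = e} =
      (if {u, w ! 0} = e then {0} else {}) \<union> Suc ` ?I" (is "?L = ?R")
  proof (rule set_eqI)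
    show "i \<in> ?L \<longleftrightarrow> i \<in> ?R" for i
      using assms by (cases i) (simp_all add: inj_image_mem_iff)
  qed
  moreover have "card ((if {u, w ! 0} = e then {0} else {}) \<union> Suc ` ?I) =
      of_bool ({u, w ! 0} = e) + card ?I"
    using fin by (simp add: card_image)
  ultimately show ?thesis
    by (simp only: parity_vector_def of_nat_add of_nat_of_bool)
qed

text \<open>The weight \<open>f\<close> and edge set \<open>F\<close> stay general to cover three
  uses: \<open>f = s\<close> on \<open>E\<close> for the sign, and \<open>f = 1\<close> on the edges
  at a vertex for the boundary or on all of \<open>E\<close> for the weight.\<close>

lemma sum_mult_parity_vector_Cons:
  assumes "finite F" "w \<noteq> []"
  shows "(\<Sum>e\<in>F. f e * parity_vector (u # w) e) =
    (if {u, w ! 0} \<in> F then f {u, w ! 0} else 0) + (\<Sum>e\<in>F. f e * parity_vector w e)"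
proof -
  have "(\<Sum>e\<in>F. f e * parity_vector (u # w) e) =
      (\<Sum>e\<in>F. (if {u, w ! 0} = e then f e else 0) + f e * parity_vector w e)"
    unfolding parity_vector_Cons[OF assms(2)] distrib_left
    by (intro sum.cong refl arg_cong2[where f = "(+)"]) simp
  then show ?thesis
    using assms(1) by (simp only: sum.distrib sum.delta')
qed

lemma sum_parity_vector_Cons:
  assumes "finite F" "w \<noteq> []"
  shows "(\<Sum>e\<in>F. parity_vector (u # w) e) =
    of_bool ({u, w ! 0} \<in> F) + (\<Sum>e\<in>F. parity_vector w e)"
  using sum_mult_parity_vector_Cons[OF assms, of "\<lambda>_. 1" u]
  by (simp only: mult_1_left of_bool_def)

lemma sign_of_bit_add: "sign_of_bit (a + b) = sign_of_bit a * sign_of_bit b"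
  by (cases a; cases b) (simp_all add: sign_of_bit_def)

text \<open>Since \<open>sign_of_bit\<close> turns addition into multiplication, prefixing an edge
  multiplies the sign of a walk by that edge's entry, which is exactly the recursion of
  \<open>matrix_power\<close>.\<close>

lemma matrix_power_signed_adjacency:
  fixes E :: "'v::finite set set"
  assumes "encodes_signing E s \<sigma>"
  shows "matrix_power (signed_adjacency E \<sigma>) l $ u $ v =
    (\<Sum>w\<in>walks E l u v. sign_of_bit (F2_dot E s (parity_vector w)))"
proof (induction l arbitrary: u)
  case 0
  then show ?case
    by (simp add: walks_0 mat_def F2_dot_def parity_vector_singleton sign_of_bit_def)
next
  case (Suc l)
  have step: "sign_of_bit (F2_dot E s (parity_vector (u # w))) =
      \<sigma> {u, x} * sign_of_bit (F2_dot E s (parity_vector w))"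
    if "{u, x} \<in> E" "w \<in> walks E l x v" for x w
  proof -
    have "w \<noteq> []" "w ! 0 = x"
      using that by (auto simp: walks_def)
    then have "F2_dot E s (parity_vector (u # w)) = s {u, x} + F2_dot E s (parity_vector w)"
      using that(1) by (simp only: F2_dot_def sum_mult_parity_vector_Cons finite simp_thms if_True)
    then show ?thesis
      using that(1) assms by (simp only: sign_of_bit_add encodes_signing_def)
  qed
  have "matrix_power (signed_adjacency E \<sigma>) (Suc l) $ u $ v =
      (\<Sum>x\<in>UNIV. if {u, x} \<in> E
         then \<sigma> {u, x} * matrix_power (signed_adjacency E \<sigma>) l $ x $ v else 0)"
    by (auto simp: matrix_matrix_mult_def signed_adjacency_def intro!: sum.cong)
  also have "\<dots> = (\<Sum>x | {u, x} \<in> E. \<sigma> {u, x} *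
      (\<Sum>w\<in>walks E l x v. sign_of_bit (F2_dot E s (parity_vector w))))"
    by (simp add: sum.If_cases Suc.IH)
  also have "\<dots> = (\<Sum>w\<in>walks E (Suc l) u v. sign_of_bit (F2_dot E s (parity_vector w)))"
    unfolding sum_walks_Suc sum_distrib_left by (intro sum.cong refl) (simp add: step)
  finally show ?case .
qed

lemma parity_vector_in_F2_space:
  assumes "w \<in> walks E l u v"
  shows "parity_vector w \<in> F2_space E"
proof -
  have "{i. Suc i < length w \<and> {w ! i, w ! Suc i} = e} = {}" if "e \<notin> E" for e
    using assms that by (auto simp: walks_def)
  then have "parity_vector w e = 0" if "e \<notin> E" for e
    using that by (simp only: parity_vector_def card.empty of_nat_0 simp_thms)
  then show ?thesis
    by (simp add: F2_space_def)
qed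

text \<open>Prefixing the edge from \<open>u\<close> to \<open>y\<close> adds the boundary
  \<open>u + y\<close>; the two copies of \<open>y\<close> cancel in characteristic 2.\<close>

lemma boundary_parity_vector:
  fixes E :: "'v::finite set set"
  assumes "simple_graph E" "w \<in> walks E l u v"
  shows "(\<Sum>e\<in>{e\<in>E. x \<in> e}. parity_vector w e) = of_bool (x = u) + of_bool (x = v)"
  using assms(2)
proof (induction l arbitrary: u w)
  case 0
  then show ?case
    by (simp add: walks_0 parity_vector_singleton split: if_splits)
next
  case (Suc l)
  then obtain y w' where y: "{u, y} \<in> E" and w': "w' \<in> walks E l y v" and w: "w = u # w'"
    by (auto simp: walks_Suc)
  have "w' \<noteq> []" "w' ! 0 = y"
    using w' by (auto simp: walks_def)
  then have "(\<Sum>e\<in>{e\<in>E. x \<in> e}. parity_vector w e) =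
      of_bool (x \<in> {u, y}) + (\<Sum>e\<in>{e\<in>E. x \<in> e}. parity_vector w' e)"
    using y by (simp only: w sum_parity_vector_Cons finite mem_Collect_eq simp_thms)
  \<comment> \<open>A loop would be the singleton of \<open>u\<close> and add 1 at \<open>u\<close>,
    where the cancellation needs 1 + 1 = 0.\<close>
  moreover have "u \<noteq> y"
    using assms(1) y by (auto simp: simple_graph_def doubleton_eq_iff)
  ultimately show ?case
    unfolding Suc.IH[OF w'] by (cases "x = u"; cases "x = y") auto
qed

text \<open>A nonzero coordinate equals 1, so the coordinate sum counts the support modulo 2; this
  makes the parity of the weight additive along a walk.\<close>

lemma of_nat_F2_weight:
  fixes E :: "'v::finite set set"
  shows "of_nat (F2_weight E z) = (\<Sum>e\<in>E. z e)"
proof -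
  have "(\<Sum>e\<in>E. z e) = (\<Sum>e\<in>{e\<in>E. z e \<noteq> 0}. 1)"
    by (rule sum.mono_neutral_cong_right) auto
  then show ?thesis
    by (simp only: F2_weight_def sum_constant mult_1_right)
qed

lemma sum_parity_vector:
  fixes E :: "'v::finite set set"
  assumes "w \<in> walks E l u v"
  shows "(\<Sum>e\<in>E. parity_vector w e) = of_nat l"
  using assms
proof (induction l arbitrary: u w)
  case 0
  then show ?case
    by (simp add: walks_0 parity_vector_singleton split: if_splits)
next
  case (Suc l)
  then obtain y w' where y: "{u, y} \<in> E" and w': "w' \<in> walks E l y v" and w: "w = u # w'"
    by (auto simp: walks_Suc)
  have "w' \<noteq> []" "w' ! 0 = y"
    using w' by (auto simp: walks_def)
  then show ?case
    using y by (simp only: w sum_parity_vector_Cons finite Suc.IH[OF w'] of_nat_Suc of_bool_eq simp_thms)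
qed

lemma of_nat_bit_eq_iff: "(of_nat m :: bit) = of_nat n \<longleftrightarrow> even m = even n"
proof -
  have "(of_nat k :: bit) = of_bool (odd k)" for k
    by (induction k) auto
  then show ?thesis
    by simp
qed

lemma parity_vector_in_even_cycle_space:
  fixes E :: "'v::finite set set"
  assumes "simple_graph E" "even l" "w \<in> walks E l u u"
  shows "parity_vector w \<in> even_cycle_space E"
proof -
  have "even (F2_weight E (parity_vector w))"
    using sum_parity_vector[OF assms(3)] assms(2)
    unfolding of_nat_F2_weight[symmetric] of_nat_bit_eq_iff by simp
  then show ?thesis
    using boundary_parity_vector[OF assms(1,3)] parity_vector_in_F2_space[OF assms(3)]
    by (simp add: even_cycle_space_def cycle_space_def)
qed

lemma closed_walks_eq_UN_walks: "{w. closed_walk E l w} = (\<Union>u. walks E l u u)"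
  by (auto simp: closed_walk_def walks_def)

theorem lemma1:
  fixes E :: "'v::finite set set"
    and \<sigma> :: "'v set \<Rightarrow> real"
    and s :: "'v set \<Rightarrow> bit"
    and l :: nat
  assumes "simple_graph E"
    and "connected_graph E"
    and "signing E \<sigma>"
    and "encodes_signing E s \<sigma>"
    and "even l"
  shows "trace (matrix_power (signed_adjacency E \<sigma>) l) =
    (\<Sum>z\<in>even_cycle_space E. real (num_closed_walks E l z) * sign_of_bit (F2_dot E s z))"
proof -
  let ?g = "\<lambda>w. sign_of_bit (F2_dot E s (parity_vector w))"
  have "trace (matrix_power (signed_adjacency E \<sigma>) l) = (\<Sum>u\<in>UNIV. \<Sum>w\<in>walks E l u u. ?g w)"
    by (simp add: trace_def matrix_power_signed_adjacency[OF assms(4)])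
  also have "\<dots> = (\<Sum>w\<in>{w. closed_walk E l w}. ?g w)"
    unfolding closed_walks_eq_UN_walks
    \<comment> \<open>The starting vertex \<open>w ! 0\<close> determines which diagonal set
      contains \<open>w\<close>.\<close>
    by (rule sum.UNION_disjoint[symmetric]) (simp_all add: finite_walks, auto simp: walks_def)
  \<comment> \<open>Grouping loses no walk, since every parity vector lies in the index set. On each
    fibre the summand is constant, so the inner sum becomes the fibre's cardinality times one
    sign.\<close>
  also have "\<dots> = (\<Sum>z\<in>even_cycle_space E.
      \<Sum>w\<in>{w \<in> {w. closed_walk E l w}. parity_vector w = z}. ?g w)"
    using parity_vector_in_even_cycle_space[OF assms(1,5)]
    by (intro sum.group[symmetric] finite_closed_walks finite_even_cycle_space)
      (auto simp: closed_walks_eq_UN_walks)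
  also have "\<dots> = (\<Sum>z\<in>even_cycle_space E.
      real (num_closed_walks E l z) * sign_of_bit (F2_dot E s z))"
    by (simp add: num_closed_walks_def)
  finally show ?thesis .
qed

end
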